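(* Let $d\ge1$, let $A\in\mathrm{GL}_d(\mathbb{R})$ with $\|A\|<1$, and let $k\in\mathbb{Z}^d$. For $\mu\in\mathbb{R}^d$ let $G_\mu\colon X\to X$ be the piecewise-affine contraction associated with $A$, $k$ and $\mu$ as defined in the context. Then $G_\mu$ is asymptotically periodic for Lebesgue almost every $\mu\in\mathbb{R}^d$.
   Context: For $x\in\mathbb{R}^d$, $\|x\|=\max_j|x_j|$, and $\|A\|=\sup_{x\ne0}\|Ax\|/\|x\|$. Let $\mathcal{A}=\{-1,+1\}^d$, and for $p\in\{0,1\}^d$ write $(-1)^p=((-1)^{p_1},\ldots,(-1)^{p_d})\in\mathcal{A}$. For $i\in\mathcal{A}$ let $\varphi_i\colon\mathbb{R}^d\to\mathbb{R}^d$, $\varphi_i(y)=Ay-(k+p)$, where $p\in\{0,1\}^d$ is the element with $(-1)^p=i$. Put $r=\frac{(1+\|A\|)(1+\|k\|)}{(1-\|A\|)^2}$ and $X=\{y\in\mathbb{R}^d\colon\|y\|\le 2r\}$; one has $\varphi_i(X)\subset\mathrm{int}(X)$ for all $i\in\mathcal{A}$. Let $A^{(j)}$ be the $j$-th row of $A$ and $v^{(j)}=A^{(j)}/\|A^{(j)}\|$. For $\mu\in\mathbb{R}^d$ define $\sigma_\mu\colon\mathbb{R}^d\to\mathcal{A}$ by $\sigma_\mu(x)=(s_1(x),\ldots,s_d(x))$, where $s_j(x)=+1$ if $\langle v^{(j)},x\rangle<\mu_j$ and $s_j(x)=-1$ if $\langle v^{(j)},x\rangle\ge\mu_j$ ($\langle\cdot,\cdot\rangle$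 is the Euclidean inner product). Define $G_\mu\colon X\to X$ by $G_\mu(y)=\varphi_{\sigma_\mu(y)}(y)$. For $y\in X$, $\omega(G_\mu,y)=\bigcap_{m\ge1}\overline{\bigcup_{n\ge m}\{G_\mu^n(y)\}}$. The map $G_\mu$ is asymptotically periodic if $\bigcup_{y\in X}\omega(G_\mu,y)$ is the union of finitely many periodic orbits of $G_\mu$. *)

theory Defs
  imports "HOL-Analysis.Analysis"
begin

text \<open>Operator norm induced by the maximum norm. The library's \<open>norm\<close> on \<open>real ^ 'd\<close> is
  Euclidean; the maximum norm is \<open>infnorm\<close>.\<close>

definition op_infnorm :: "real ^ 'd ^ 'd \<Rightarrow> real" where
  "op_infnorm A = (SUP x\<in>{x. x \<noteq> 0}. infnorm (A *v x) / infnorm x)"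

definition signs :: "(int ^ 'd) set" where
  "signs = {i. \<forall>j. i $ j \<in> {-1, 1}}"

definition sign_vec :: "nat ^ 'd \<Rightarrow> int ^ 'd" where
  "sign_vec p = (\<chi> j. (-1) ^ (p $ j))"

text \<open>The inverse of \<open>p \<mapsto> (-1)\<^sup>p\<close> on \<open>{0,1}\<^sup>d\<close>; only meaningful on \<open>signs\<close>.\<close>

definition sign_exponent :: "int ^ 'd \<Rightarrow> nat ^ 'd" where
  "sign_exponent i = (THE p. (\<forall>j. p $ j \<in> {0, 1}) \<and> sign_vec p = i)"

definition real_vec :: "int ^ 'd \<Rightarrow> real ^ 'd" where
  "real_vec k = (\<chi> j. real_of_int (k $ j))"

definition branch :: "real ^ 'd ^ 'd \<Rightarrow> int ^ 'd \<Rightarrow> int ^ 'd \<Rightarrow> real ^ 'd \<Rightarrow> real ^ 'd" where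
  "branch A k i y = A *v y - (real_vec k + (\<chi> j. real (sign_exponent i $ j)))"

definition radius :: "real ^ 'd ^ 'd \<Rightarrow> int ^ 'd \<Rightarrow> real" where
  "radius A k = (1 + op_infnorm A) * (1 + infnorm (real_vec k)) / (1 - op_infnorm A)\<^sup>2"

definition domain_X :: "real ^ 'd ^ 'd \<Rightarrow> int ^ 'd \<Rightarrow> (real ^ 'd) set" where
  "domain_X A k = {y. infnorm y \<le> 2 * radius A k}"

definition unit_row :: "real ^ 'd ^ 'd \<Rightarrow> 'd \<Rightarrow> real ^ 'd" where
  "unit_row A j = row j A /\<^sub>R infnorm (row j A)"

definition coding :: "real ^ 'd ^ 'd \<Rightarrow> real ^ 'd \<Rightarrow> real ^ 'd \<Rightarrow> int ^ 'd" where
  "coding A \<mu> x = (\<chi> j. if unit_row A j \<bullet> x < \<mu> $ j then 1 else -1)"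

text \<open>A total function on \<open>real ^ 'd\<close>; only its restriction to \<open>domain_X A k\<close>, which it maps
  into itself when \<open>op_infnorm A < 1\<close>, is of interest.\<close>

definition G_map :: "real ^ 'd ^ 'd \<Rightarrow> int ^ 'd \<Rightarrow> real ^ 'd \<Rightarrow> real ^ 'd \<Rightarrow> real ^ 'd" where
  "G_map A k \<mu> y = branch A k (coding A \<mu> y) y"

definition omega_limit :: "('a::topological_space \<Rightarrow> 'a) \<Rightarrow> 'a \<Rightarrow> 'a set" where
  "omega_limit G y = (\<Inter>m\<in>{1..}. closure (\<Union>n\<in>{m..}. {(G ^^ n) y}))"

definition periodic_orbit :: "'a set \<Rightarrow> ('a \<Rightarrow> 'a) \<Rightarrow> 'a set \<Rightarrow> bool" where
  "periodic_orbit X G P \<longleftrightarrow>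
     (\<exists>y\<in>X. \<exists>m\<ge>1. (G ^^ m) y = y \<and> P = range (\<lambda>n. (G ^^ n) y))"

text \<open>For a self-map of a closed set \<open>X\<close>, so that closures taken in the ambient space and in
  \<open>X\<close> agree.\<close>

definition asymptotically_periodic ::
    "('a::topological_space) set \<Rightarrow> ('a \<Rightarrow> 'a) \<Rightarrow> bool" where
  "asymptotically_periodic X G \<longleftrightarrow>
     (\<exists>\<P>. finite \<P> \<and> (\<forall>P\<in>\<P>. periodic_orbit X G P) \<and>
        (\<Union>y\<in>X. omega_limit G y) = \<Union>\<P>)"

lemma sign_exponent_signs:
  assumes "i \<in> signs"
  shows "sign_exponent i = (\<chi> j. if i $ j = 1 then 0 else 1)"
  unfolding sign_exponent_def
proof (rule the_equality)
  show "(\<forall>j. (\<chi> j. if i $ j = 1 then 0 else (1::nat)) $ j \<in> {0, 1}) \<and>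
      sign_vec (\<chi> j. if i $ j = 1 then 0 else 1) = i"
    using assms by (auto simp: signs_def sign_vec_def vec_eq_iff) metis
next
  fix p :: "nat ^ 'a"
  assume p: "(\<forall>j. p $ j \<in> {0, 1}) \<and> sign_vec p = i"
  show "p = (\<chi> j. if i $ j = 1 then 0 else 1)"
  proof (simp add: vec_eq_iff, intro allI)
    fix j
    have "i $ j = (-1) ^ (p $ j)" "p $ j \<in> {0, 1}"
      using p by (auto simp: sign_vec_def)
    then show "(i $ j = 1 \<longrightarrow> p $ j = 0) \<and> (i $ j \<noteq> 1 \<longrightarrow> p $ j = Suc 0)"
      by auto
  qed
qed

lemma coding_in_signs: "coding A \<mu> x \<in> signs"
  by (simp add: coding_def signs_def)

lemma op_infnorm_bound: "infnorm (A *v x) \<le> op_infnorm A * infnorm x"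
proof (cases "x = 0")
  case True
  then show ?thesis by (simp add: infnorm_0)
next
  case False
  then have pos: "0 < infnorm x" by (simp add: infnorm_pos_lt)
  obtain B where B: "\<And>z. norm (A *v z) \<le> norm z * B"
    using bounded_linear.bounded[OF matrix_vector_mul_bounded_linear[of A]] by blast
  have "infnorm (A *v z) / infnorm z \<le> sqrt DIM(real ^ 'a) * \<bar>B\<bar>" if "z \<noteq> 0" for z
  proof -
    have "infnorm (A *v z) \<le> norm z * B" using infnorm_le_norm B order_trans by blast
    also have "\<dots> \<le> norm z * \<bar>B\<bar>" by (intro mult_left_mono) auto
    also have "\<dots> \<le> (sqrt DIM(real ^ 'a) * infnorm z) * \<bar>B\<bar>"
      by (intro mult_right_mono norm_le_infnorm) auto
    finally show ?thesis using that by (simp add: divide_simps infnorm_pos_lt mult.commute mult.left_commute)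
  qed
  then have "bdd_above ((\<lambda>x. infnorm (A *v x) / infnorm x) ` {x. x \<noteq> 0})"
    by (auto intro!: bdd_aboveI2)
  then have "infnorm (A *v x) / infnorm x \<le> op_infnorm A"
    unfolding op_infnorm_def using False by (intro cSUP_upper) auto
  then show ?thesis using pos by (simp add: divide_simps)
qed

lemma G_map_domain_X:
  assumes "op_infnorm A < 1" and "y \<in> domain_X A k"
  shows "G_map A k \<mu> y \<in> domain_X A k"
proof -
  let ?a = "op_infnorm A" and ?r = "radius A k" and ?K = "infnorm (real_vec k)"
  let ?p = "\<chi> j. real (sign_exponent (coding A \<mu> y) $ j)"
  have a0: "0 \<le> ?a"
  proof -
    have "0 \<le> ?a * infnorm (1 :: real ^ 'a)"
      using op_infnorm_bound[of A 1] infnorm_pos_le[of "A *v 1"] by linarith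
    moreover have "0 < infnorm (1 :: real ^ 'a)"
      by (simp add: infnorm_pos_lt vec_eq_iff)
    ultimately show ?thesis by (simp add: zero_le_mult_iff)
  qed
  have p: "infnorm ?p \<le> 1"
    unfolding infnorm_Max
    by (auto simp: sign_exponent_signs[OF coding_in_signs] Basis_vec_def inner_axis intro!: Max.boundedI)
  have "infnorm (G_map A k \<mu> y) \<le> infnorm (A *v y) + infnorm (real_vec k + ?p)"
    unfolding G_map_def branch_def
    using infnorm_triangle[of "A *v y" "- (real_vec k + ?p)"] infnorm_neg[of "real_vec k + ?p"]
    by (simp only: add_uminus_conv_diff)
  also have "\<dots> \<le> ?a * (2 * ?r) + (?K + 1)"
  proof (rule add_mono)
    show "infnorm (A *v y) \<le> ?a * (2 * ?r)"
      using op_infnorm_bound[of A y] assms(2) mult_left_mono[OF _ a0, of "infnorm y" "2 * ?r"]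
      by (auto simp: domain_X_def)
    show "infnorm (real_vec k + ?p) \<le> ?K + 1"
      using infnorm_triangle[of "real_vec k" ?p] p by linarith
  qed
  also have "\<dots> \<le> 2 * ?r"
  proof -
    have "0 \<le> ?K" by (rule infnorm_pos_le)
    have "(1 - ?a) * ?r = (1 + ?a) * (1 + ?K) / (1 - ?a)"
      using assms(1) by (simp add: radius_def power2_eq_square)
    also have "\<dots> \<ge> 1 + ?K"
    proof -
      have "(1 + ?K) * (1 - ?a) \<le> (1 + ?K) * (1 + ?a)"
        using a0 \<open>0 \<le> ?K\<close> by (intro mult_left_mono) auto
      then show ?thesis using assms(1) by (simp add: le_divide_eq mult.commute)
    qed
    finally show ?thesis using \<open>0 \<le> ?K\<close> by (simp add: algebra_simps)
  qed
  finally show ?thesis by (simp add: domain_X_def)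
qed

end

theory Submission
  imports Defs "HOL-Real_Asymp.Real_Asymp"
begin

text \<open>Track a point together with the word of symbols it visits. A word of length \<open>n\<close> determines the
  \<open>n\<close>-th iterate up to an error of order \<open>c ^ n\<close>. All branches have the same linear part, so in the
  space of pairs of a point and a parameter the jumps of the first \<open>m\<close> symbols near a given pair lie
  on at most \<open>m * d\<close> hyperplanes with fixed normals; these cut out only polynomially many (in \<open>m\<close>)
  sign patterns. Since images of cells shrink, the number of words of length \<open>n\<close> visited for some
  parameter in a small ball therefore grows more slowly than \<open>(1 / c) ^ n\<close>, and the parameters for which
  some discontinuity hyperplane meets the \<open>n\<close>-th images for every \<open>n\<close> form a null set. For all other
  parameters the next symbol is a function of the last \<open>n\<close> symbols, and the map acts as a
  contraction over a finite state machine.\<close>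

section \<open>Shattering and sign patterns of linear forms\<close>

definition shatters :: "'a set set \<Rightarrow> 'a set \<Rightarrow> bool" where
  "shatters \<F> S \<longleftrightarrow> (\<forall>T\<subseteq>S. \<exists>U\<in>\<F>. U \<inter> S = T)"

text \<open>Pajor's form of the Sauer-Shelah lemma. Induction on the ground set: split the family by
  membership of \<open>x\<close> and delete \<open>x\<close> from the second half. A set
  \<open>S\<close> shattered by both halves accounts for two shattered sets of the whole family,
  \<open>S\<close> and \<open>insert x S\<close>.\<close>

lemma card_le_card_shattered:
  assumes "finite V" "\<F> \<subseteq> Pow V"
  shows "card \<F> \<le> card {S. S \<subseteq> V \<and> shatters \<F> S}"
  using assms
proof (induction V arbitrary: \<F> rule: finite_induct)
  case empty
  then have "\<F> = {} \<or> \<F> = {{}}" by auto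
  then consider "\<F> = {}" | "\<F> = {{}}" by blast
  then show ?case
  proof cases
    case 2
    then have "{S. S \<subseteq> {} \<and> shatters \<F> S} = {{}}" by (auto simp: shatters_def)
    with 2 show ?thesis by simp
  qed simp
next
  case (insert x V)
  define \<F>0 where "\<F>0 = {U\<in>\<F>. x \<notin> U}"
  define \<F>1 where "\<F>1 = (\<lambda>U. U - {x}) ` {U\<in>\<F>. x \<in> U}"
  define Sh where "Sh \<G> = {S. S \<subseteq> V \<and> shatters \<G> S}" for \<G>
  have finV: "finite (Sh \<G>)" for \<G>
    using insert.hyps(1) by (auto simp: Sh_def)
  have fin: "finite \<F>" using insert.prems insert.hyps(1) by (meson finite_Pow_iff finite_insert finite_subset)
  have F0: "\<F>0 \<subseteq> Pow V" and F1: "\<F>1 \<subseteq> Pow V"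
    using insert.prems by (auto simp: \<F>0_def \<F>1_def)
  have "card {U\<in>\<F>. x \<in> U} = card \<F>1"
    unfolding \<F>1_def by (rule card_image[symmetric]) (auto simp: inj_on_def)
  moreover have "card \<F> = card \<F>0 + card {U\<in>\<F>. x \<in> U}"
    unfolding \<F>0_def using fin
    by (subst card_Un_disjoint[symmetric]) (auto intro: arg_cong[where f=card])
  ultimately have "card \<F> = card \<F>0 + card \<F>1" by simp
  also have "\<dots> \<le> card (Sh \<F>0) + card (Sh \<F>1)"
    using insert.IH[OF F0] insert.IH[OF F1] by (simp add: Sh_def)
  \<comment> \<open>Sets shattered by both halves are counted twice here; the second count is
    transferred to the sets \<open>insert x S\<close>.\<close>
  also have "\<dots> = card (Sh \<F>0 \<union> Sh \<F>1) + card (Sh \<F>0 \<inter> Sh \<F>1)"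
    by (rule card_Un_Int) (rule finV)+
  also have "card (Sh \<F>0 \<inter> Sh \<F>1) = card (insert x ` (Sh \<F>0 \<inter> Sh \<F>1))"
    using insert.hyps(2) by (intro card_image[symmetric]) (auto simp: inj_on_def Sh_def)
  also have "card (Sh \<F>0 \<union> Sh \<F>1) + \<dots> = card ((Sh \<F>0 \<union> Sh \<F>1) \<union> insert x ` (Sh \<F>0 \<inter> Sh \<F>1))"
    using insert.hyps(2) finV by (intro card_Un_disjoint[symmetric]) (auto simp: Sh_def)
  also have "\<dots> \<le> card {S. S \<subseteq> insert x V \<and> shatters \<F> S}"
  proof (rule card_mono)
    show "finite {S. S \<subseteq> insert x V \<and> shatters \<F> S}" using insert.hyps(1) by simp
    have 0: "shatters \<F> S" if "S \<in> Sh \<F>0" for S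
      using that unfolding Sh_def shatters_def \<F>0_def by blast
    have 1: "shatters \<F> S" if S: "S \<in> Sh \<F>1" for S
      unfolding shatters_def
    proof (intro allI impI)
      fix T assume "T \<subseteq> S"
      then obtain U' where "U' \<in> \<F>1" "U' \<inter> S = T"
        using S unfolding Sh_def shatters_def by blast
      then obtain U where "U \<in> \<F>" "(U - {x}) \<inter> S = T"
        unfolding \<F>1_def by blast
      moreover have "x \<notin> S" using S insert.hyps(2) by (auto simp: Sh_def)
      ultimately show "\<exists>U\<in>\<F>. U \<inter> S = T" by blast
    qed
    have 2: "shatters \<F> (insert x S)" if S: "S \<in> Sh \<F>0" "S \<in> Sh \<F>1" for S
      unfolding shatters_def
    proof (intro allI impI)
      fix T assume T: "T \<subseteq> insert x S"
      have xS: "x \<notin> S" using S insert.hyps(2) by (auto simp: Sh_def)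
      show "\<exists>U\<in>\<F>. U \<inter> insert x S = T"
      proof (cases "x \<in> T")
        case True
        have "T - {x} \<subseteq> S" using T by blast
        then obtain U' where "U' \<in> \<F>1" "U' \<inter> S = T - {x}"
          using S(2) unfolding Sh_def shatters_def by blast
        then obtain U where "U \<in> \<F>" "x \<in> U" "(U - {x}) \<inter> S = T - {x}"
          unfolding \<F>1_def by auto
        then show ?thesis using True xS by (intro bexI[of _ U]) auto
      next
        case False
        then have "T \<subseteq> S" using T by blast
        then obtain U where "U \<in> \<F>0" "U \<inter> S = T"
          using S(1) unfolding Sh_def shatters_def by blast
        then show ?thesis using False unfolding \<F>0_def by (intro bexI[of _ U]) auto
      qed
    qed
    show "Sh \<F>0 \<union> Sh \<F>1 \<union> insert x ` (Sh \<F>0 \<inter> Sh \<F>1) \<subseteq> {S. S \<subseteq> insert x V \<and> shatters \<F> S}"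
      using 0 1 2 by (auto simp: Sh_def)
  qed
  finally show ?case .
qed

text \<open>A subset with at most \<open>D\<close> elements is listed as a word of length
  \<open>D\<close> over \<open>V\<close> enlarged by the padding symbol \<open>None\<close>.\<close>

lemma card_small_subsets_le:
  assumes "finite V"
  shows "card {S. S \<subseteq> V \<and> card S \<le> D} \<le> (card V + 1) ^ D"
proof -
  let ?O = "insert None (Some ` V)"
  have cO: "card ?O = card V + 1"
    using assms by (simp add: card_image)
  have "{S. S \<subseteq> V \<and> card S \<le> D} \<subseteq> (\<lambda>ys. {x. Some x \<in> set ys}) ` {ys. set ys \<subseteq> ?O \<and> length ys = D}"
  proof
    fix S assume "S \<in> {S. S \<subseteq> V \<and> card S \<le> D}"
    then have S: "S \<subseteq> V" "card S \<le> D" by auto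
    obtain xs where xs: "set xs = S" "distinct xs"
      using finite_distinct_list assms S(1) finite_subset by metis
    have "length xs \<le> D" using xs S distinct_card by fastforce
    then show "S \<in> (\<lambda>ys. {x. Some x \<in> set ys}) ` {ys. set ys \<subseteq> ?O \<and> length ys = D}"
      using xs S by (intro image_eqI[of _ _ "map Some xs @ replicate (D - length xs) None"])
        (auto simp: set_replicate_conv_if)
  qed
  then have "card {S. S \<subseteq> V \<and> card S \<le> D} \<le> card {ys. set ys \<subseteq> ?O \<and> length ys = D}"
    using assms by (intro surj_card_le finite_lists_length_eq) auto
  also have "\<dots> = (card V + 1) ^ D"
    using assms cO by (subst card_lists_length_eq) auto
  finally show ?thesis .
qed

text \<open>A linear dependency \<open>\<Sum>u i *\<^sub>R a i = 0\<close> with some \<open>u i > 0\<close> excludes the sign pattern that is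
  negative exactly where \<open>u\<close> is positive, so a shattered family is independent.\<close>

lemma card_sign_patterns_le:
  fixes a :: "'i \<Rightarrow> 'e::euclidean_space"
  assumes "finite I"
  shows "card (range (\<lambda>z. {i\<in>I. 0 \<le> a i \<bullet> z})) \<le> (card I + 1) ^ DIM('e)"
proof -
  let ?F = "range (\<lambda>z. {i\<in>I. 0 \<le> a i \<bullet> z})"
  have "card S \<le> DIM('e)" if S: "S \<subseteq> I" "shatters ?F S" for S
  proof -
    have pattern: "\<exists>z. \<forall>i\<in>S. 0 \<le> a i \<bullet> z \<longleftrightarrow> i \<in> T" if T: "T \<subseteq> S" for T
    proof -
      obtain z where "{i\<in>I. 0 \<le> a i \<bullet> z} \<inter> S = T"
        using S(2) T unfolding shatters_def by blast
      then show ?thesis using S(1) by (intro exI[of _ z]) blast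
    qed
    have inj: "inj_on a S"
    proof (rule inj_onI, rule ccontr)
      fix i j assume ij: "i \<in> S" "j \<in> S" "a i = a j" "i \<noteq> j"
      then obtain z where "\<forall>i'\<in>S. 0 \<le> a i' \<bullet> z \<longleftrightarrow> i' \<in> {i}"
        using pattern[of "{i}"] by blast
      then have "0 \<le> a i \<bullet> z" "\<not> 0 \<le> a j \<bullet> z" using ij(1,2,4) by auto
      then show False using ij(3) by simp
    qed
    have fS: "finite S" using S(1) assms finite_subset by blast
    have "independent (a ` S)"
    proof
      assume "dependent (a ` S)"
      then obtain u b where u: "(\<Sum>b\<in>a ` S. u b *\<^sub>R b) = 0" and b: "b \<in> a ` S" "u b \<noteq> 0"
        using fS by (auto simp: dependent_finite)
      \<comment> \<open>The dependency is multiplied by a sign to make the coefficient at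
        \<open>b\<close> positive.\<close>
      define w where "w b' = sgn (u b) * u b'" for b'
      have w0: "(\<Sum>i\<in>S. w (a i) *\<^sub>R a i) = 0"
      proof -
        have "(\<Sum>i\<in>S. w (a i) *\<^sub>R a i) = (\<Sum>b\<in>a ` S. w b *\<^sub>R b)"
          using inj by (simp add: sum.reindex)
        also have "\<dots> = sgn (u b) *\<^sub>R (\<Sum>b\<in>a ` S. u b *\<^sub>R b)"
          by (simp add: w_def scaleR_sum_right)
        finally show ?thesis using u by simp
      qed
      obtain i0 where i0: "i0 \<in> S" "b = a i0" using b by auto
      then have pos: "w (a i0) > 0" using b by (simp add: w_def sgn_if)
      obtain z where z: "\<And>i. i \<in> S \<Longrightarrow> 0 \<le> a i \<bullet> z \<longleftrightarrow> i \<in> {i\<in>S. w (a i) \<le> 0}"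
        using pattern[of "{i\<in>S. w (a i) \<le> 0}"] by blast
      have "(\<Sum>i\<in>S. w (a i) * (a i \<bullet> z)) < (\<Sum>i\<in>S. 0)"
      proof (rule sum_strict_mono_ex1[OF fS])
        show "\<forall>i\<in>S. w (a i) * (a i \<bullet> z) \<le> 0"
          using z by (force simp: mult_le_0_iff)
        show "\<exists>i\<in>S. w (a i) * (a i \<bullet> z) < 0"
          using z[OF i0(1)] pos i0(1) by (intro bexI[of _ i0]) (auto simp: mult_less_0_iff)
      qed
      moreover have "(\<Sum>i\<in>S. w (a i) * (a i \<bullet> z)) = (\<Sum>i\<in>S. w (a i) *\<^sub>R a i) \<bullet> z"
        by (simp add: inner_sum_left)
      ultimately show False using w0 by simp
    qed
    then have "card (a ` S) \<le> DIM('e)" using independent_bound by blast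
    then show ?thesis using inj by (simp add: card_image)
  qed
  then have "{S. S \<subseteq> I \<and> shatters ?F S} \<subseteq> {S. S \<subseteq> I \<and> card S \<le> DIM('e)}" by blast
  then have "card {S. S \<subseteq> I \<and> shatters ?F S} \<le> card {S. S \<subseteq> I \<and> card S \<le> DIM('e)}"
    using assms by (intro card_mono) auto
  moreover have "card ?F \<le> card {S. S \<subseteq> I \<and> shatters ?F S}"
    using assms by (intro card_le_card_shattered) auto
  ultimately show ?thesis using card_small_subsets_le[OF assms, of "DIM('e)"] by linarith
qed

text \<open>Supplies the block length \<open>m\<close> for which contraction over one block beats
  the number of local words of that length.\<close>

lemma polynomial_times_power_less_1:
  fixes c :: real
  assumes "0 < c" "c < 1"
  shows "\<exists>m\<ge>1. real ((m * d + 1) ^ D) * c ^ m < 1"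
proof -
  have "((\<lambda>m. (real m * real d + 1) ^ D * c ^ m) \<longlonglongrightarrow> 0)"
  proof (cases "d = 0")
    case True then show ?thesis using assms by (simp add: LIMSEQ_realpow_zero)
  next
    case False
    then have "real d > 0" by simp
    then show ?thesis using assms by real_asymp
  qed
  then have "\<forall>\<^sub>F m in sequentially. (real m * real d + 1) ^ D * c ^ m < 1"
    by (rule order_tendstoD) simp
  then obtain N where "\<And>m. m \<ge> N \<Longrightarrow> (real m * real d + 1) ^ D * c ^ m < 1"
    unfolding eventually_sequentially by blast
  from this[of "max N 1"] show ?thesis
    by (intro exI[of _ "max N 1"]) (simp add: add.commute)
qed

section \<open>Omega-limit sets and contractions over a finite state machine\<close>

lemma omega_limit_iff:
  fixes G :: "'a::metric_space \<Rightarrow> 'a"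
  shows "p \<in> omega_limit G x \<longleftrightarrow> (\<forall>m. \<forall>e>0. \<exists>n\<ge>m. dist ((G ^^ n) x) p < e)"
proof -
  have "p \<in> omega_limit G x \<longleftrightarrow> (\<forall>m\<ge>1. \<forall>e>0. \<exists>n\<ge>m. dist ((G ^^ n) x) p < e)"
    by (auto simp: omega_limit_def closure_approachable)
  also have "\<dots> \<longleftrightarrow> (\<forall>m. \<forall>e>0. \<exists>n\<ge>m. dist ((G ^^ n) x) p < e)"
  proof (intro iffI allI impI)
    fix m :: nat and e :: real
    assume "\<forall>m\<ge>1. \<forall>e>0. \<exists>n\<ge>m. dist ((G ^^ n) x) p < e" "e > 0"
    then obtain n where "n \<ge> max 1 m" "dist ((G ^^ n) x) p < e" by (meson max.cobounded1)
    then show "\<exists>n\<ge>m. dist ((G ^^ n) x) p < e" by auto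
  qed auto
  finally show ?thesis .
qed

lemma omega_limit_funpow:
  fixes G :: "'a::metric_space \<Rightarrow> 'a"
  shows "omega_limit G ((G ^^ i) x) = omega_limit G x"
proof (intro set_eqI iffI)
  fix p assume p: "p \<in> omega_limit G ((G ^^ i) x)"
  show "p \<in> omega_limit G x"
    unfolding omega_limit_iff
  proof (intro allI impI)
    fix m and e :: real assume "e > 0"
    then obtain n where "n \<ge> m" "dist ((G ^^ n) ((G ^^ i) x)) p < e"
      using p unfolding omega_limit_iff by blast
    then show "\<exists>n\<ge>m. dist ((G ^^ n) x) p < e"
      by (intro exI[of _ "n + i"]) (simp add: funpow_add)
  qed
next
  fix p assume p: "p \<in> omega_limit G x"
  show "p \<in> omega_limit G ((G ^^ i) x)"
    unfolding omega_limit_iff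
  proof (intro allI impI)
    fix m and e :: real assume "e > 0"
    then obtain n where n: "n \<ge> m + i" "dist ((G ^^ n) x) p < e"
      using p unfolding omega_limit_iff by blast
    then have "(G ^^ (n - i)) ((G ^^ i) x) = (G ^^ n) x"
      by (simp flip: funpow_add[THEN fun_cong, unfolded o_apply])
    then show "\<exists>n\<ge>m. dist ((G ^^ n) ((G ^^ i) x)) p < e"
      using n by (intro exI[of _ "n - i"]) auto
  qed
qed

lemma omega_limit_subset_asymptotic:
  fixes G :: "'a::metric_space \<Rightarrow> 'a"
  assumes "(\<lambda>n. dist ((G ^^ n) x) ((G ^^ n) y)) \<longlonglongrightarrow> 0"
  shows "omega_limit G x \<subseteq> omega_limit G y"
proof
  fix p assume p: "p \<in> omega_limit G x"
  show "p \<in> omega_limit G y"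
    unfolding omega_limit_iff
  proof (intro allI impI)
    fix m and e :: real assume e: "e > 0"
    obtain N where N: "\<And>n. n \<ge> N \<Longrightarrow> dist ((G ^^ n) x) ((G ^^ n) y) < e / 2"
      using order_tendstoD(2)[OF assms, of "e/2"] e by (auto simp: eventually_sequentially)
    obtain n where n: "n \<ge> max m N" "dist ((G ^^ n) x) p < e / 2"
      using p e unfolding omega_limit_iff by (meson half_gt_zero)
    then have "dist ((G ^^ n) y) p < e"
      using N[of n] dist_triangle3[of "(G ^^ n) y" p "(G ^^ n) x"] by auto
    then show "\<exists>n\<ge>m. dist ((G ^^ n) y) p < e" using n by auto
  qed
qed

lemma omega_limit_eq_asymptotic:
  fixes G :: "'a::metric_space \<Rightarrow> 'a"
  assumes "(\<lambda>n. dist ((G ^^ n) x) ((G ^^ n) y)) \<longlonglongrightarrow> 0"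
  shows "omega_limit G x = omega_limit G y"
  using omega_limit_subset_asymptotic[OF assms] omega_limit_subset_asymptotic[of G y x] assms
  by (simp add: dist_commute subset_antisym)

lemma funpow_periodic:
  assumes "(G ^^ q) z = z"
  shows "(G ^^ (n + t * q)) z = (G ^^ n) z"
proof -
  have "(G ^^ (t * q)) z = z"
    using assms by (induction t) (auto simp: funpow_add)
  then show ?thesis by (simp add: funpow_add)
qed

text \<open>The orbit is finite, hence closed, and each of its points recurs every \<open>q\<close>
  steps.\<close>

lemma omega_limit_periodic:
  fixes G :: "'a::metric_space \<Rightarrow> 'a"
  assumes "(G ^^ q) z = z" "q \<ge> 1"
  shows "omega_limit G z = range (\<lambda>n. (G ^^ n) z)"
proof
  have "(G ^^ n) z \<in> (\<lambda>n. (G ^^ n) z) ` {..<q}" for n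
  proof -
    have "(G ^^ n) z = (G ^^ (n mod q)) z"
      using funpow_periodic[OF assms(1), of "n mod q" "n div q"] by simp
    then show ?thesis using assms(2) by auto
  qed
  then have "range (\<lambda>n. (G ^^ n) z) \<subseteq> (\<lambda>n. (G ^^ n) z) ` {..<q}" by blast
  then have "closed (range (\<lambda>n. (G ^^ n) z))"
    by (meson finite_imp_closed finite_imageI finite_lessThan finite_subset)
  moreover have "omega_limit G z \<subseteq> closure (range (\<lambda>n. (G ^^ n) z))"
    unfolding omega_limit_def by (rule INF_lower2[of 1], simp, rule closure_mono) auto
  ultimately show "omega_limit G z \<subseteq> range (\<lambda>n. (G ^^ n) z)" by simp
  show "range (\<lambda>n. (G ^^ n) z) \<subseteq> omega_limit G z"
  proof safe
    fix n
    show "(G ^^ n) z \<in> omega_limit G z"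
      unfolding omega_limit_iff
    proof (intro allI impI)
      fix m and e :: real assume "e > 0"
      moreover have "m \<le> n + m * q" using assms(2) by (simp add: trans_le_add2)
      ultimately show "\<exists>n'\<ge>m. dist ((G ^^ n') z) ((G ^^ n) z) < e"
        using funpow_periodic[OF assms(1), of n m] by (intro exI[of _ "n + m * q"]) auto
    qed
  qed
qed

lemma finite_funpow_recurrent:
  assumes "finite F" "\<And>w. w \<in> F \<Longrightarrow> \<sigma> w \<in> F" "w \<in> F"
  shows "\<exists>i q. q \<ge> 1 \<and> (\<sigma> ^^ (q + i)) w = (\<sigma> ^^ i) w"
proof -
  have "(\<sigma> ^^ n) w \<in> F" for n using assms by (induction n) auto
  then have "finite (range (\<lambda>n. (\<sigma> ^^ n) w))"
    using assms(1) by (meson finite_subset image_subsetI)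
  then have "\<not> inj (\<lambda>n. (\<sigma> ^^ n) w)" using finite_imageD infinite_UNIV_nat by blast
  then obtain i j where "i < j" "(\<sigma> ^^ i) w = (\<sigma> ^^ j) w"
    unfolding inj_def by (metis linorder_neqE_nat)
  then show ?thesis by (intro exI[of _ i] exI[of _ "j - i"]) auto
qed

text \<open>All points of one piece \<open>K w\<close> share their omega-limit set. The state
  sequence eventually cycles, and a suitable power of \<open>G\<close> along the cycle is a
  contraction of a piece into itself, whose Banach fixed point is periodic. By
  \<open>absorb\<close>, the finitely many pieces account for all limit sets.\<close>

lemma asymptotically_periodic_finite_state:
  fixes G :: "'a::metric_space \<Rightarrow> 'a"
  assumes F: "finite F" "\<And>w. w \<in> F \<Longrightarrow> \<sigma> w \<in> F"
    and K: "\<And>w. w \<in> F \<Longrightarrow> K w \<subseteq> X" "\<And>w. w \<in> F \<Longrightarrow> complete (K w)"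
      "\<And>w. w \<in> F \<Longrightarrow> K w \<noteq> {}"
    and GK: "\<And>w y. w \<in> F \<Longrightarrow> y \<in> K w \<Longrightarrow> G y \<in> K (\<sigma> w)"
    and c: "0 \<le> c" "c < (1::real)" 
    and contr: "\<And>w y z n. w \<in> F \<Longrightarrow> y \<in> K w \<Longrightarrow> z \<in> K w \<Longrightarrow>
        dist ((G ^^ n) y) ((G ^^ n) z) \<le> C * c ^ n * dist y z"
    and absorb: "\<And>x. x \<in> X \<Longrightarrow> \<exists>n. \<exists>w\<in>F. (G ^^ n) x \<in> K w"
  shows "asymptotically_periodic X G"
proof -
  have sF: "(\<sigma> ^^ n) w \<in> F" if "w \<in> F" for w n using F(2) that by (induction n) auto
  have sK: "(G ^^ n) y \<in> K ((\<sigma> ^^ n) w)" if "w \<in> F" "y \<in> K w" for w y n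
    using that GK sF by (induction n) auto
  have Cc: "(\<lambda>n. C * c ^ n * r) \<longlonglongrightarrow> 0" for r
  proof -
    have "(\<lambda>n. C * c ^ n * r) \<longlonglongrightarrow> C * 0 * r"
      using c by (intro tendsto_intros LIMSEQ_realpow_zero)
    then show ?thesis by simp
  qed
  have om: "omega_limit G y = omega_limit G z" if "w \<in> F" "y \<in> K w" "z \<in> K w" for w y z
    by (rule omega_limit_eq_asymptotic, rule tendsto_sandwich[OF _ _ tendsto_const Cc[of "dist y z"]])
      (use contr that in auto)
  have orbit: "\<exists>z\<in>X. \<exists>q\<ge>1. (G ^^ q) z = z \<and> omega_limit G y = range (\<lambda>n. (G ^^ n) z)"
    if w: "w \<in> F" and y: "y \<in> K w" for w y
  proof -
    obtain i q where q: "q \<ge> 1" "(\<sigma> ^^ (q + i)) w = (\<sigma> ^^ i) w"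
      using finite_funpow_recurrent[of F \<sigma>, OF F w] by blast
    define w' where "w' = (\<sigma> ^^ i) w"
    have w': "w' \<in> F" "(\<sigma> ^^ q) w' = w'" using sF w q by (auto simp: w'_def funpow_add)
    obtain N where N: "\<And>n. n \<ge> N \<Longrightarrow> C * c ^ n * 1 < 1 / 2"
      using order_tendstoD(2)[OF Cc[of 1], of "1/2"] by (auto simp: eventually_sequentially)
    \<comment> \<open>A multiple of the state period \<open>q\<close>, so \<open>K w'\<close> is
      mapped into itself, and at least \<open>N\<close>, so the Lipschitz constant is at most 1/2
      despite the factor \<open>C\<close>.\<close>
    define q' where "q' = (N + 1) * q"
    have "(N + 1) * 1 \<le> q'" unfolding q'_def using q(1) by (intro mult_left_mono) auto
    then have q': "q' \<ge> 1" "q' \<ge> N" by auto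
    have "(\<sigma> ^^ q') w' = w'" using funpow_periodic[OF w'(2), of 0 "N + 1"] by (simp add: q'_def)
    then have inv: "(G ^^ q') ` K w' \<subseteq> K w'" using sK[OF w'(1), of _ q'] by auto
    have "dist ((G ^^ q') a) ((G ^^ q') b) \<le> 1/2 * dist a b" if "a \<in> K w'" "b \<in> K w'" for a b
    proof -
      have "C * c ^ q' \<le> 1/2" using N[OF q'(2)] by simp
      then show ?thesis
        using contr[OF w'(1) that, of q'] mult_right_mono[of "C * c ^ q'" "1/2" "dist a b"] by auto
    qed
    then obtain z where z: "z \<in> K w'" "(G ^^ q') z = z"
      using Banach_fix[OF K(2)[OF w'(1)] K(3)[OF w'(1)] _ _ inv, of "1/2"] by auto
    have "omega_limit G y = omega_limit G ((G ^^ i) y)" by (simp add: omega_limit_funpow)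
    also have "\<dots> = omega_limit G z" using om[OF w'(1) _ z(1)] sK[OF w y, of i] by (simp add: w'_def)
    also have "\<dots> = range (\<lambda>n. (G ^^ n) z)" using omega_limit_periodic z(2) q'(1) by blast
    finally show ?thesis using z q' K(1)[OF w'(1)] by blast
  qed
  define \<P> where "\<P> = omega_limit G ` X"
  define k where "k w = (SOME y. y \<in> K w)" for w
  have k: "k w \<in> K w" if "w \<in> F" for w unfolding k_def using K(3)[OF that] by (simp add: some_in_eq)
  have rep: "\<exists>w\<in>F. omega_limit G x = omega_limit G (k w)" if x: "x \<in> X" for x
  proof -
    obtain n w where w: "w \<in> F" "(G ^^ n) x \<in> K w" using absorb[OF x] by blast
    from om[OF this k[OF w(1)]] show ?thesis using w(1) unfolding omega_limit_funpow by blast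
  qed
  then have "\<P> \<subseteq> (\<lambda>w. omega_limit G (k w)) ` F" by (auto simp: \<P>_def)
  then have "finite \<P>" using F(1) finite_surj by blast
  moreover have "periodic_orbit X G P" if P: "P \<in> \<P>" for P
  proof -
    obtain x where "x \<in> X" "P = omega_limit G x" using P unfolding \<P>_def by blast
    then obtain w where w: "w \<in> F" "P = omega_limit G (k w)" using rep by blast
    from orbit[OF w(1) k[OF w(1)]] show ?thesis unfolding periodic_orbit_def w(2) by blast
  qed
  ultimately show ?thesis
    unfolding asymptotically_periodic_def by (intro exI[of _ \<P>]) (auto simp: \<P>_def)
qed

section \<open>Auxiliary facts on cardinality, linear iterates and volume\<close>

lemma card_image_le_factor:
  assumes "finite (g ` A)" and "\<And>x y. x \<in> A \<Longrightarrow> y \<in> A \<Longrightarrow> g x = g y \<Longrightarrow> f x = f y"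
  shows "card (f ` A) \<le> card (g ` A)"
proof (rule surj_card_le[OF assms(1)])
  show "f ` A \<subseteq> (f \<circ> inv_into A g) ` (g ` A)"
  proof
    fix b assume "b \<in> f ` A"
    then obtain x where x: "x \<in> A" "b = f x" by blast
    then have "f (inv_into A g (g x)) = f x"
      by (intro assms(2)) (auto simp: inv_into_into f_inv_into_f)
    then show "b \<in> (f \<circ> inv_into A g) ` (g ` A)" using x by force
  qed
qed

lemma linear_funpow:
  fixes L :: "'a::real_vector \<Rightarrow> 'a"
  assumes "linear L"
  shows "linear (L ^^ n)"
proof (induction n)
  case 0
  then show ?case by (simp add: linear_iff)
next
  case (Suc n)
  then show ?case using linear_compose[OF Suc assms] by (simp add: o_def)
qed

text \<open>The slab is enclosed in a box with one side of length \<open>2 * \<epsilon>\<close> and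
  all others of length \<open>2 * \<delta>\<close>.\<close>

lemma measure_slab_le:
  fixes \<mu>0 :: "real ^ 'd"
  assumes "\<epsilon> \<ge> 0" "\<delta> \<ge> 0"
  shows "\<exists>T. T \<in> lmeasurable \<and> {\<mu>\<in>ball \<mu>0 \<delta>. \<bar>\<mu> $ j - s\<bar> \<le> \<epsilon>} \<subseteq> T \<and>
    measure lebesgue T \<le> 2 * \<epsilon> * (2 * \<delta>) ^ (CARD('d) - 1)"
proof (intro exI conjI)
  let ?a = "\<chi> i. if i = j then s - \<epsilon> else \<mu>0 $ i - \<delta>"
  let ?b = "\<chi> i. if i = j then s + \<epsilon> else \<mu>0 $ i + \<delta>"
  show "cbox ?a ?b \<in> lmeasurable" by simp
  show "{\<mu>\<in>ball \<mu>0 \<delta>. \<bar>\<mu> $ j - s\<bar> \<le> \<epsilon>} \<subseteq> cbox ?a ?b"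
  proof
    fix \<mu> assume \<mu>: "\<mu> \<in> {\<mu>\<in>ball \<mu>0 \<delta>. \<bar>\<mu> $ j - s\<bar> \<le> \<epsilon>}"
    have "\<bar>\<mu>0 $ i - \<mu> $ i\<bar> < \<delta>" for i
      using \<mu> component_le_norm_cart[of "\<mu>0 - \<mu>" i] by (simp add: dist_norm)
    then have "\<mu>0 $ i - \<delta> \<le> \<mu> $ i \<and> \<mu> $ i \<le> \<mu>0 $ i + \<delta>" for i
      by (smt (verit))
    then show "\<mu> \<in> cbox ?a ?b" using \<mu> by (auto simp: mem_box_cart)
  qed
  have "cbox ?a ?b \<noteq> {}" using assms by (auto simp: interval_ne_empty_cart)
  then have "measure lebesgue (cbox ?a ?b) = (\<Prod>i\<in>UNIV. ?b $ i - ?a $ i)"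
    by (simp add: content_cbox_cart)
  also have "\<dots> = (\<Prod>i\<in>UNIV. if i = j then 2 * \<epsilon> else 2 * \<delta>)"
    by (intro prod.cong) auto
  also have "\<dots> = 2 * \<epsilon> * (2 * \<delta>) ^ (CARD('d) - 1)"
    by (subst prod.remove[of _ j]) (auto simp: card_Diff_singleton)
  finally show "measure lebesgue (cbox ?a ?b) \<le> 2 * \<epsilon> * (2 * \<delta>) ^ (CARD('d) - 1)" by simp
qed

section \<open>Affine contractions with a common linear part, and their words\<close>

text \<open>The constant \<open>C\<close> allows \<open>L\<close> to contract in a norm other than
  the Euclidean one. Invariance is demanded for every symbol \<open>S\<close>, so arbitrary words
  may be followed inside \<open>X\<close>, not only those visited by an orbit.\<close>

locale affine_contraction =
  fixes L :: "'a::euclidean_space \<Rightarrow> 'a" and \<tau> :: "'d::finite set \<Rightarrow> 'a"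
    and v :: "'d \<Rightarrow> 'a" and X :: "'a set" and C c :: real
  assumes linear: "linear L"
    and c: "0 < c" "c < 1"
    and contraction: "norm ((L ^^ n) x) \<le> C * c ^ n * norm x"
    and compact: "compact X" and nonempty: "X \<noteq> {}"
    and invariant: "y \<in> X \<Longrightarrow> L y - \<tau> S \<in> X"
begin

text \<open>A sign vector is encoded by the set of coordinates with sign -1.\<close>

definition code :: "real ^ 'd \<Rightarrow> 'a \<Rightarrow> 'd set" where
  "code \<mu> y = {j. \<mu> $ j \<le> v j \<bullet> y}"

definition step :: "real ^ 'd \<Rightarrow> 'a \<Rightarrow> 'a" where
  "step \<mu> y = L y - \<tau> (code \<mu> y)"

fun word :: "real ^ 'd \<Rightarrow> nat \<Rightarrow> 'a \<Rightarrow> 'd set list" where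
  "word \<mu> 0 y = []"
| "word \<mu> (Suc n) y = code \<mu> y # word \<mu> n (step \<mu> y)"

definition follow :: "'d set list \<Rightarrow> 'a \<Rightarrow> 'a" where
  "follow w y = foldl (\<lambda>y S. L y - \<tau> S) y w"

lemma follow_simps [simp]:
  "follow [] y = y"
  "follow (S # w) y = follow w (L y - \<tau> S)"
  "follow (w @ w') y = follow w' (follow w y)"
  by (simp_all add: follow_def)

lemma length_word [simp]: "length (word \<mu> n y) = n"
  by (induction n arbitrary: y) auto

lemma funpow_step: "(step \<mu> ^^ n) y = follow (word \<mu> n y) y"
proof (induction n arbitrary: y)
  case (Suc n)
  have "(step \<mu> ^^ Suc n) y = (step \<mu> ^^ n) (step \<mu> y)" by (simp add: funpow_swap1)
  also have "\<dots> = follow (word \<mu> n (step \<mu> y)) (step \<mu> y)" by (rule Suc)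
  also have "\<dots> = follow (word \<mu> (Suc n) y) y" by (simp add: step_def)
  finally show ?case .
qed simp

lemma word_add: "word \<mu> (m + n) y = word \<mu> m y @ word \<mu> n (follow (word \<mu> m y) y)"
  by (induction m arbitrary: y) (auto simp: step_def)

lemma follow_in: "y \<in> X \<Longrightarrow> follow w y \<in> X"
  by (induction w arbitrary: y) (auto intro: invariant)

lemma follow_diff: "follow w y - follow w z = (L ^^ length w) (y - z)"
proof (induction w arbitrary: y z)
  case (Cons S w)
  have "L y - \<tau> S - (L z - \<tau> S) = L (y - z)" using linear by (simp add: linear_diff)
  then show ?case using Cons by (simp add: funpow_swap1)
qed simp

lemma dist_follow_le: "dist (follow w y) (follow w z) \<le> C * c ^ length w * dist y z"
  using contraction by (simp add: dist_norm follow_diff)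

lemma continuous_follow: "continuous_on UNIV (follow w)"
proof (induction w)
  case (Cons S w)
  have "continuous_on UNIV (\<lambda>y. L y - \<tau> S)"
    using linear by (intro continuous_intros linear_continuous_on) (simp add: linear_conv_bounded_linear)
  from continuous_on_compose2[OF Cons this] show ?case by simp
qed simp

lemma C_nonneg: "0 \<le> C"
proof -
  obtain b :: 'a where "b \<in> Basis" using nonempty_Basis by blast
  then have "norm b = 1" by simp
  then show ?thesis using contraction[of 0 b] norm_ge_zero[of b] by simp
qed

section \<open>Local count of words through hyperplane patterns\<close>

text \<open>\<open>gap (x0, \<mu>0) w j\<close> is the position of \<open>(x0, \<mu>0)\<close> relative to the hyperplane where the \<open>j\<close>-th symbol
  after the word \<open>w\<close> jumps, in the space of pairs of a point and a parameter. For nearby pairs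
  only the hyperplanes through \<open>(x0, \<mu>0)\<close> matter; since all branches share the linear part \<open>L\<close>,
  their normals \<open>hyp (i, j)\<close> depend on \<open>w\<close> only through its length \<open>i\<close>.\<close>

definition hyp :: "nat \<times> 'd \<Rightarrow> 'a \<times> (real ^ 'd)" where
  "hyp ij = (adjoint (L ^^ fst ij) (v (snd ij)), - axis (snd ij) 1)"

lemma hyp_inner: "hyp (i, j) \<bullet> (u, \<eta>) = v j \<bullet> (L ^^ i) u - \<eta> $ j"
  using adjoint_works[OF linear_funpow[OF linear, of i], of u "v j"]
  by (simp add: hyp_def inner_axis' inner_commute[of _ u] inner_commute[of _ "v j"])

definition gap :: "'a \<times> (real ^ 'd) \<Rightarrow> 'd set list \<Rightarrow> 'd \<Rightarrow> real" where
  "gap p w j = v j \<bullet> follow w (fst p) - snd p $ j"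

text \<open>For a fixed word the tested quantity is affine in the pair of point and parameter; this
  is its expansion about \<open>p0\<close>.\<close>

lemma code_follow_iff:
  "j \<in> code \<mu> (follow w y) \<longleftrightarrow> 0 \<le> gap p0 w j + hyp (length w, j) \<bullet> ((y, \<mu>) - p0)"
proof -
  obtain x0 \<mu>0 where p0: "p0 = (x0, \<mu>0)" by (cases p0)
  have "v j \<bullet> follow w y - v j \<bullet> follow w x0 = v j \<bullet> (L ^^ length w) (y - x0)"
    by (simp add: follow_diff flip: inner_diff_right)
  then show ?thesis by (simp add: code_def p0 hyp_inner gap_def) linarith
qed

text \<open>Makes every nonzero \<open>gap\<close> outweigh the linear term in
  \<open>code_follow_iff\<close>, so that its sign alone decides the symbol.\<close>

definition small :: "nat \<Rightarrow> 'a \<times> (real ^ 'd) \<Rightarrow> 'a \<times> (real ^ 'd) \<Rightarrow> bool" where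
  "small m p0 p \<longleftrightarrow> (\<forall>w\<in>{w. length w < m}. \<forall>j\<in>UNIV.
     gap p0 w j \<noteq> 0 \<longrightarrow> \<bar>hyp (length w, j) \<bullet> (p - p0)\<bar> < \<bar>gap p0 w j\<bar>)"

text \<open>Finitely many words and coordinates are involved, and each strict inequality is open and
  holds at \<open>p0\<close>.\<close>

lemma eventually_small: "\<forall>\<^sub>F p in nhds p0. small m p0 p"
  unfolding small_def
proof (intro eventually_ball_finite ballI)
  show "finite {w :: 'd set list. length w < m}"
    by (rule finite_subset[OF _ finite_lists_length_le[of UNIV m]]) auto
  fix w :: "'d set list" and j :: 'd
  have "((\<lambda>p. \<bar>hyp (length w, j) \<bullet> (p - p0)\<bar>) \<longlongrightarrow> \<bar>hyp (length w, j) \<bullet> (p0 - p0)\<bar>) (nhds p0)"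
    by (intro tendsto_intros filterlim_ident)
  then have "\<forall>\<^sub>F p in nhds p0. \<bar>hyp (length w, j) \<bullet> (p - p0)\<bar> < \<bar>gap p0 w j\<bar>"
    if "gap p0 w j \<noteq> 0" using that by (intro order_tendstoD(2)) auto
  then show "\<forall>\<^sub>F p in nhds p0. gap p0 w j \<noteq> 0 \<longrightarrow>
      \<bar>hyp (length w, j) \<bullet> (p - p0)\<bar> < \<bar>gap p0 w j\<bar>"
    by (cases "gap p0 w j = 0") (auto elim: eventually_mono)
qed auto

text \<open>Induction on prefixes: after a common prefix both pairs are tested against the same
  \<open>gap\<close>. A nonzero one dominates by smallness; a zero one leaves the sign of the
  \<open>hyp\<close> term, on which the patterns agree.\<close>

lemma word_eq_of_sign_pattern:
  assumes s: "small m p0 (y, \<mu>)" "small m p0 (y', \<mu>')"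
    and pat: "\<And>i j. i < m \<Longrightarrow>
      0 \<le> hyp (i, j) \<bullet> ((y, \<mu>) - p0) \<longleftrightarrow> 0 \<le> hyp (i, j) \<bullet> ((y', \<mu>') - p0)"
  shows "word \<mu> m y = word \<mu>' m y'"
proof -
  have "word \<mu> i y = word \<mu>' i y'" if "i \<le> m" for i
    using that
  proof (induction i)
    case (Suc i)
    define w where "w = word \<mu> i y"
    have w: "w = word \<mu>' i y'" "length w < m" "length w = i" using Suc by (auto simp: w_def)
    have "j \<in> code \<mu> (follow w y) \<longleftrightarrow> j \<in> code \<mu>' (follow w y')" for j
    proof (cases "gap p0 w j = 0")
      case True
      then show ?thesis using pat[of i j] w by (simp add: code_follow_iff[of _ _ _ _ p0])
    next
      case False
      then have "\<bar>hyp (i, j) \<bullet> ((y, \<mu>) - p0)\<bar> < \<bar>gap p0 w j\<bar>"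
        "\<bar>hyp (i, j) \<bullet> ((y', \<mu>') - p0)\<bar> < \<bar>gap p0 w j\<bar>"
        using s[unfolded small_def, THEN bspec, of w, THEN bspec, of j] w by auto
      then show ?thesis using w by (simp add: code_follow_iff[of _ _ _ _ p0]) argo
    qed
    then have "code \<mu> (follow w y) = code \<mu>' (follow w y')" by blast
    then have "word \<mu> (i + 1) y = word \<mu>' (i + 1) y'"
      unfolding word_add using w by (simp add: w_def)
    then show ?case by simp
  qed simp
  then show ?thesis by simp
qed

lemma card_word_small_le:
  "card ((\<lambda>(y, \<mu>). word \<mu> m y) ` {p. small m p0 p}) \<le> (m * CARD('d) + 1) ^ DIM('a \<times> (real ^ 'd))"
proof -
  let ?I = "{..<m} \<times> (UNIV :: 'd set)"
  define pat where "pat p = {ij\<in>?I. 0 \<le> hyp ij \<bullet> (p - p0)}" for p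
  have fin: "finite (pat ` A)" for A
    by (rule finite_subset[of _ "Pow ?I"]) (auto simp: pat_def)
  have "card ((\<lambda>(y, \<mu>). word \<mu> m y) ` {p. small m p0 p}) \<le> card (pat ` {p. small m p0 p})"
  proof (rule card_image_le_factor[OF fin], safe)
    fix y \<mu> y' \<mu>' assume "small m p0 (y, \<mu>)" "small m p0 (y', \<mu>')" and "pat (y, \<mu>) = pat (y', \<mu>')"
    then show "word \<mu> m y = word \<mu>' m y'"
      by (intro word_eq_of_sign_pattern) (auto simp: pat_def set_eq_iff)
  qed
  also have "\<dots> \<le> card (range (\<lambda>z. {ij\<in>?I. 0 \<le> hyp ij \<bullet> z}))"
    by (rule card_mono) (auto simp: pat_def intro: finite_subset[of _ "Pow ?I"])
  also have "\<dots> \<le> (card ?I + 1) ^ DIM('a \<times> (real ^ 'd))"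
    by (rule card_sign_patterns_le) simp
  finally show ?thesis by (simp add: card_cartesian_product)
qed

lemma finite_words: "finite ((\<lambda>(y, \<mu>). word \<mu> m y) ` A)"
  by (rule finite_subset[OF _ finite_lists_length_eq[of UNIV m]]) auto

text \<open>The local bound holds near each pair in the compact set
  \<open>X \<times> {\<mu>0}\<close>; a Lebesgue number of the resulting cover gives one radius for
  all of \<open>X\<close>.\<close>

lemma ex_uniform_local_words:
  "\<exists>\<delta>>0. \<forall>x\<in>X. card ((\<lambda>(y, \<mu>). word \<mu> m y) ` (ball x \<delta> \<times> ball \<mu>0 \<delta>)) \<le> (m * CARD('d) + 1) ^ DIM('a \<times> (real ^ 'd))"
proof -
  let ?N = "\<lambda>A. card ((\<lambda>(y, \<mu>). word \<mu> m y) ` A)"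
  define \<G> where "\<G> = {U. open U \<and> ?N U \<le> (m * CARD('d) + 1) ^ DIM('a \<times> (real ^ 'd))}"
  have "X \<times> {\<mu>0} \<subseteq> \<Union>\<G>"
  proof
    fix p0 assume "p0 \<in> X \<times> {\<mu>0}"
    obtain U where U: "open U" "p0 \<in> U" "U \<subseteq> {p. small m p0 p}"
      using eventually_small[of m p0] unfolding eventually_nhds by blast
    have "?N U \<le> ?N {p. small m p0 p}" using U(3) by (intro card_mono finite_words image_mono)
    then have "U \<in> \<G>" using U(1) card_word_small_le[of m p0] by (auto simp: \<G>_def)
    then show "p0 \<in> \<Union>\<G>" using U(2) by blast
  qed
  moreover have "compact (X \<times> {\<mu>0})" using compact by (intro compact_Times) auto
  ultimately obtain e where e: "e > 0" "\<And>p. p \<in> X \<times> {\<mu>0} \<Longrightarrow> \<exists>U\<in>\<G>. ball p e \<subseteq> U"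
    using Heine_Borel_lemma[of "X \<times> {\<mu>0}" \<G>] unfolding \<G>_def by blast
  have "?N (ball x (e/2) \<times> ball \<mu>0 (e/2)) \<le> (m * CARD('d) + 1) ^ DIM('a \<times> (real ^ 'd))" if x: "x \<in> X" for x
  proof -
    obtain U where U: "U \<in> \<G>" "ball (x, \<mu>0) e \<subseteq> U" using e(2)[of "(x, \<mu>0)"] x by auto
    have "ball x (e/2) \<times> ball \<mu>0 (e/2) \<subseteq> ball (x, \<mu>0) e"
    proof safe
      fix y \<mu> assume "y \<in> ball x (e/2)" "\<mu> \<in> ball \<mu>0 (e/2)"
      then have "dist x y + dist \<mu>0 \<mu> < e" by simp
      then show "(y, \<mu>) \<in> ball (x, \<mu>0) e"
        using sqrt_sum_squares_le_sum[of "dist x y" "dist \<mu>0 \<mu>"] by (simp add: dist_Pair_Pair)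
    qed
    then have "?N (ball x (e/2) \<times> ball \<mu>0 (e/2)) \<le> ?N U"
      using U(2) by (intro card_mono finite_words image_mono) blast
    then show ?thesis using U(1) by (simp add: \<G>_def)
  qed
  then show ?thesis using e(1) by (intro exI[of _ "e/2"]) auto
qed

section \<open>Global growth of the number of words\<close>

definition words :: "(real ^ 'd) set \<Rightarrow> nat \<Rightarrow> 'd set list set" where
  "words Q n = (\<lambda>(y, \<mu>). word \<mu> n y) ` (X \<times> Q)"

text \<open>After the first \<open>n\<close> symbols \<open>w\<close>, the point lies within
  \<open>\<delta>\<close> of \<open>follow w x0\<close>, whatever its start. Hence at most
  \<open>P\<close> continuations of length \<open>m\<close> extend each \<open>w\<close>.\<close>

lemma card_words_add_le:
  assumes loc: "\<And>x. x \<in> X \<Longrightarrow> card ((\<lambda>(y, \<mu>). word \<mu> m y) ` (ball x \<delta> \<times> Q)) \<le> P"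
    and \<delta>: "\<And>y z. y \<in> X \<Longrightarrow> z \<in> X \<Longrightarrow> C * c ^ n * dist y z < \<delta>"
  shows "card (words Q (n + m)) \<le> card (words Q n) * P"
proof -
  obtain x0 where x0: "x0 \<in> X" using nonempty by blast
  define E where "E w = (\<lambda>(y, \<mu>). word \<mu> m y) ` (ball (follow w x0) \<delta> \<times> Q)" for w
  have fin: "finite (words Q n)" unfolding words_def by (rule finite_words)
  have "words Q (n + m) \<subseteq> (\<Union>w\<in>words Q n. (@) w ` E w)"
  proof
    fix u assume "u \<in> words Q (n + m)"
    then obtain y \<mu> where y: "y \<in> X" "\<mu> \<in> Q" "u = word \<mu> (n + m) y" by (auto simp: words_def)
    define w where "w = word \<mu> n y"
    have "dist (follow w x0) (follow w y) < \<delta>"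
      using dist_follow_le[of w x0 y] \<delta>[OF x0 y(1)] by (simp add: w_def)
    then have "word \<mu> m (follow w y) \<in> E w" using y by (force simp: E_def)
    moreover have "w \<in> words Q n" using y by (force simp: words_def w_def)
    ultimately show "u \<in> (\<Union>w\<in>words Q n. (@) w ` E w)"
      unfolding y(3) word_add by (auto simp: w_def)
  qed
  then have "card (words Q (n + m)) \<le> card (\<Union>w\<in>words Q n. (@) w ` E w)"
    using fin by (intro card_mono) (auto simp: E_def intro: finite_words)
  also have "\<dots> \<le> (\<Sum>w\<in>words Q n. card ((@) w ` E w))" by (rule card_UN_le[OF fin])
  also have "\<dots> \<le> (\<Sum>w\<in>words Q n. P)"
  proof (rule sum_mono)
    fix w assume "w \<in> words Q n"
    have "card ((@) w ` E w) \<le> card (E w)" by (rule card_image_le) (auto simp: E_def intro: finite_words)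
    also have "\<dots> \<le> P" unfolding E_def by (rule loc[OF follow_in[OF x0]])
    finally show "card ((@) w ` E w) \<le> P" .
  qed
  finally show ?thesis by simp
qed

text \<open>First \<open>m\<close> is fixed, then \<open>\<delta>\<close> is chosen for this
  \<open>m\<close>. Once images of words have shrunk below \<open>\<delta>\<close>, each further
  block of \<open>m\<close> symbols multiplies the weighted count by at most a fixed ratio below
  1.\<close>

lemma ex_words_decay:
  "\<exists>\<delta>>0. \<forall>\<epsilon>>0. \<exists>n. real (card (words (ball \<mu>0 \<delta>) n)) * c ^ n < \<epsilon>"
proof -
  obtain m where m: "m \<ge> 1" "real ((m * CARD('d) + 1) ^ DIM('a \<times> (real ^ 'd))) * c ^ m < 1"
    using polynomial_times_power_less_1[OF c, of "CARD('d)" "DIM('a \<times> (real ^ 'd))"] by blast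
  obtain \<delta> where \<delta>: "\<delta> > 0"
    "\<And>x. x \<in> X \<Longrightarrow> card ((\<lambda>(y, \<mu>). word \<mu> m y) ` (ball x \<delta> \<times> ball \<mu>0 \<delta>)) \<le> (m * CARD('d) + 1) ^ DIM('a \<times> (real ^ 'd))"
    using ex_uniform_local_words[of m \<mu>0] by blast
  let ?N = "\<lambda>n. real (card (words (ball \<mu>0 \<delta>) n))"
  obtain R where R: "\<And>y z. y \<in> X \<Longrightarrow> z \<in> X \<Longrightarrow> dist y z \<le> R"
    using compact_imp_bounded[OF compact] unfolding bounded_two_points by blast
  have "(\<lambda>n. C * c ^ n * R) \<longlonglongrightarrow> C * 0 * R"
    using c by (intro tendsto_intros LIMSEQ_realpow_zero) auto
  then have "\<forall>\<^sub>F n in sequentially. C * c ^ n * R < \<delta>"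
    using \<delta>(1) by (intro order_tendstoD(2)) auto
  then obtain n0 where n0: "\<And>n. n \<ge> n0 \<Longrightarrow> C * c ^ n * R < \<delta>"
    unfolding eventually_sequentially by blast
  have grow: "?N (n + m) \<le> ?N n * (m * CARD('d) + 1) ^ DIM('a \<times> (real ^ 'd))" if "n \<ge> n0" for n
  proof -
    have "C * c ^ n * dist y z < \<delta>" if "y \<in> X" "z \<in> X" for y z
    proof -
      have "C * c ^ n * dist y z \<le> C * c ^ n * R"
        using C_nonneg c R[OF that] by (intro mult_left_mono) auto
      then show ?thesis using n0[OF \<open>n \<ge> n0\<close>] by linarith
    qed
    then have "card (words (ball \<mu>0 \<delta>) (n + m)) \<le> card (words (ball \<mu>0 \<delta>) n) * (m * CARD('d) + 1) ^ DIM('a \<times> (real ^ 'd))"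
      using \<delta>(2) by (intro card_words_add_le)
    then show ?thesis by (metis of_nat_le_iff of_nat_mult)
  qed
  let ?r = "real ((m * CARD('d) + 1) ^ DIM('a \<times> (real ^ 'd))) * c ^ m"
  have iter: "?N (n0 + q * m) * c ^ (n0 + q * m) \<le> ?N n0 * c ^ n0 * ?r ^ q" for q
  proof (induction q)
    case (Suc q)
    have "?N (n0 + Suc q * m) * c ^ (n0 + Suc q * m) = ?N ((n0 + q * m) + m) * (c ^ (n0 + q * m) * c ^ m)"
      by (simp add: power_add add_ac)
    also have "\<dots> \<le> ?N (n0 + q * m) * (m * CARD('d) + 1) ^ DIM('a \<times> (real ^ 'd)) * (c ^ (n0 + q * m) * c ^ m)"
      using c by (intro mult_right_mono grow) auto
    also have "\<dots> = (?N (n0 + q * m) * c ^ (n0 + q * m)) * ?r" by (simp only: mult_ac)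
    also have "\<dots> \<le> (?N n0 * c ^ n0 * ?r ^ q) * ?r"
      using c by (intro mult_right_mono Suc) auto
    finally show ?case by (simp add: mult_ac)
  qed simp
  have "(\<lambda>q. ?N n0 * c ^ n0 * ?r ^ q) \<longlonglongrightarrow> ?N n0 * c ^ n0 * 0"
    using m(2) c by (intro tendsto_intros LIMSEQ_realpow_zero) auto
  then have "\<exists>q. ?N n0 * c ^ n0 * ?r ^ q < \<epsilon>" if "\<epsilon> > 0" for \<epsilon>
    using that order_tendstoD(2)[of _ _ sequentially \<epsilon>] eventually_happens'
    by (metis (no_types, lifting) mult_zero_right sequentially_bot)
  then show ?thesis using \<delta>(1) iter by (meson le_less_trans)
qed

section \<open>Finite-state dynamics at good parameters\<close>

lemma asymptotically_periodic_step:
  assumes hom: "\<And>w y z. w \<in> words {\<mu>} n \<Longrightarrow> y \<in> X \<Longrightarrow> z \<in> X \<Longrightarrow>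
    code \<mu> (follow w y) = code \<mu> (follow w z)"
  shows "asymptotically_periodic X (step \<mu>)"
proof -
  obtain x0 where x0: "x0 \<in> X" using nonempty by blast
  define F where "F = words {\<mu>} n"
  define \<kappa> where "\<kappa> w = code \<mu> (follow w x0)" for w
  \<comment> \<open>Appending before dropping the head makes the shift correct for
    \<open>n = 0\<close> too, where it returns the empty word.\<close>
  define \<sigma> where "\<sigma> w = tl (w @ [\<kappa> w])" for w
  define K where "K w = follow w ` X" for w
  have code: "code \<mu> (follow w y) = \<kappa> w" if "w \<in> F" "y \<in> X" for w y
    using hom[OF _ that(2) x0] that(1) unfolding F_def \<kappa>_def by blast
  have stepX: "step \<mu> y \<in> X" if "y \<in> X" for y using invariant[OF that] by (simp add: step_def)
  have funX: "(step \<mu> ^^ t) y \<in> X" if "y \<in> X" for y t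
    using stepX that by (induction t) auto
  have shift: "word \<mu> n (step \<mu> y) = \<sigma> (word \<mu> n y)" if "y \<in> X" for y
  proof -
    have "word \<mu> n y \<in> F" using that by (force simp: F_def words_def)
    then have "word \<mu> (n + 1) y = word \<mu> n y @ [\<kappa> (word \<mu> n y)]"
      using code that unfolding word_add by simp
    then have "\<sigma> (word \<mu> n y) = tl (word \<mu> (n + 1) y)" unfolding \<sigma>_def by simp
    then show ?thesis by simp
  qed
  have \<sigma>F: "\<sigma> w \<in> F" if w: "w \<in> F" for w
  proof -
    obtain y where y: "y \<in> X" "w = word \<mu> n y" using w by (auto simp: F_def words_def)
    then have "\<sigma> w = word \<mu> n (step \<mu> y)" by (simp add: shift)
    then show ?thesis using stepX[OF y(1)] by (force simp: F_def words_def)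
  qed
  have GK: "\<exists>y'\<in>X. step \<mu> (follow w y) = follow (\<sigma> w) y'" if "w \<in> F" "y \<in> X" for w y
  proof (intro bexI)
    let ?S = "hd (w @ [\<kappa> w])"
    have "step \<mu> (follow w y) = follow (w @ [\<kappa> w]) y"
      using code that by (simp add: step_def)
    also have "w @ [\<kappa> w] = ?S # \<sigma> w" by (simp add: \<sigma>_def)
    also have "follow (?S # \<sigma> w) y = follow (\<sigma> w) (L y - \<tau> ?S)" by (rule follow_simps)
    finally show "step \<mu> (follow w y) = follow (\<sigma> w) (L y - \<tau> ?S)" .
    show "L y - \<tau> ?S \<in> X" using that by (intro invariant)
  qed
  \<comment> \<open>Points of one piece have the same entire future itinerary, so all later iterates
    differ only by powers of \<open>L\<close>.\<close>
  have same: "word \<mu> t a = word \<mu> t b" if "w \<in> F" "a \<in> K w" "b \<in> K w" for w a b t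
    using that
  proof (induction t arbitrary: w a b)
    case (Suc t)
    have "step \<mu> a \<in> K (\<sigma> w)" "step \<mu> b \<in> K (\<sigma> w)"
      using GK Suc.prems unfolding K_def by blast+
    then have "word \<mu> t (step \<mu> a) = word \<mu> t (step \<mu> b)"
      using Suc.IH \<sigma>F Suc.prems(1) by blast
    moreover have "code \<mu> a = code \<mu> b" using code Suc.prems by (auto simp: K_def)
    ultimately show ?case by simp
  qed simp
  show ?thesis
  proof (rule asymptotically_periodic_finite_state)
    show "finite F" unfolding F_def words_def by (rule finite_words)
    show "K w \<subseteq> X" for w using follow_in by (auto simp: K_def)
    show "complete (K w)" for w
      unfolding K_def using compact continuous_on_subset[OF continuous_follow]
      by (intro compact_imp_complete compact_continuous_image) auto
    show "K w \<noteq> {}" for w using nonempty by (simp add: K_def)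
    show "step \<mu> y \<in> K (\<sigma> w)" if "w \<in> F" "y \<in> K w" for w y
      using GK that unfolding K_def by blast
    show "dist ((step \<mu> ^^ t) y) ((step \<mu> ^^ t) z) \<le> C * c ^ t * dist y z"
      if "w \<in> F" "y \<in> K w" "z \<in> K w" for w y z t
      using same[OF that, of t] dist_follow_le[of "word \<mu> t y" y z] by (simp add: funpow_step)
    show "\<exists>m. \<exists>w\<in>F. (step \<mu> ^^ m) y \<in> K w" if "y \<in> X" for y
      using that by (intro exI[of _ n] bexI[of _ "word \<mu> n y"]) (auto simp: funpow_step K_def F_def words_def)
  qed (use c \<sigma>F in auto)
qed

section \<open>The exceptional parameters form a null set\<close>

text \<open>If the \<open>j\<close>-th discontinuity hyperplane stays away from the sets \<open>follow w ` X\<close> of some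
  generation \<open>n\<close>, the next symbol is a function of the last \<open>n\<close> ones. The remaining parameters lie,
  for every \<open>n\<close>, in one slab of width of order \<open>c ^ n\<close> for each word and each \<open>j\<close>.\<close>

lemma negligible_not_asymptotically_periodic:
  "negligible {\<mu>. \<not> asymptotically_periodic X (step \<mu>)}"
proof (rule iffD2[OF locally_negligible_alt], rule ballI)
  fix \<mu>0 assume \<mu>0: "\<mu>0 \<in> {\<mu>. \<not> asymptotically_periodic X (step \<mu>)}"
  let ?B = "{\<mu>. \<not> asymptotically_periodic X (step \<mu>)}"
  obtain x0 where x0: "x0 \<in> X" using nonempty by blast
  obtain \<delta> where \<delta>: "\<delta> > 0" "\<And>\<epsilon>. \<epsilon> > 0 \<Longrightarrow> \<exists>n. real (card (words (ball \<mu>0 \<delta>) n)) * c ^ n < \<epsilon>"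
    using ex_words_decay[of \<mu>0] by blast
  obtain R where R: "\<And>y z. y \<in> X \<Longrightarrow> z \<in> X \<Longrightarrow> dist y z \<le> R"
    using compact_imp_bounded[OF compact] unfolding bounded_two_points by blast
  have R0: "0 \<le> R" using R[OF x0 x0] by simp
  define M where "M = (\<Sum>j\<in>UNIV. norm (v j))"
  have M: "norm (v j) \<le> M" for j unfolding M_def by (rule member_le_sum) auto
  have M0: "0 \<le> M" by (simp add: M_def sum_nonneg)
  \<comment> \<open>Bounds how far \<open>v j \<bullet> follow w y\<close> can move from its value
    at \<open>x0\<close> when \<open>w\<close> has length \<open>n\<close>.\<close>
  define width where "width n = M * (C * c ^ n * R)" for n
  have width0: "0 \<le> width n" for n using M0 C_nonneg c R0 by (simp add: width_def)
  have width: "\<bar>v j \<bullet> follow w y - v j \<bullet> follow w x0\<bar> \<le> width (length w)" if "y \<in> X" for j w y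
  proof -
    have "\<bar>v j \<bullet> (follow w y - follow w x0)\<bar> \<le> norm (v j) * norm (follow w y - follow w x0)"
      by (rule Cauchy_Schwarz_ineq2)
    also have "\<dots> \<le> M * (C * c ^ length w * R)"
    proof (rule mult_mono[OF M _ M0])
      have "norm (follow w y - follow w x0) \<le> C * c ^ length w * dist y x0"
        using dist_follow_le[of w y x0] by (simp add: dist_norm)
      also have "\<dots> \<le> C * c ^ length w * R"
        using C_nonneg c R[OF that x0] by (intro mult_left_mono) auto
      finally show "norm (follow w y - follow w x0) \<le> C * c ^ length w * R" .
    qed simp
    finally show ?thesis by (simp add: width_def inner_diff_right)
  qed
  define W where "W n = words (ball \<mu>0 \<delta>) n" for n
  have finW: "finite (W n)" for n unfolding W_def words_def by (rule finite_words)
  have lenW: "length w = n" if "w \<in> W n" for w n using that by (auto simp: W_def words_def)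
  have cover: "\<exists>w\<in>W n. \<exists>j. \<bar>\<mu> $ j - v j \<bullet> follow w x0\<bar> \<le> width n"
    if \<mu>: "\<mu> \<in> ?B \<inter> ball \<mu>0 \<delta>" for \<mu> n
  proof (rule ccontr)
    assume far: "\<not> (\<exists>w\<in>W n. \<exists>j. \<bar>\<mu> $ j - v j \<bullet> follow w x0\<bar> \<le> width n)"
    have "asymptotically_periodic X (step \<mu>)"
    proof (rule asymptotically_periodic_step)
      fix w y z assume w: "w \<in> words {\<mu>} n" and yz: "y \<in> X" "z \<in> X"
      have wW: "w \<in> W n" using w \<mu> by (auto simp: W_def words_def)
      have "code \<mu> (follow w y) = code \<mu> (follow w x0)" if "y \<in> X" for y
      proof -
        have "\<mu> $ j \<le> v j \<bullet> follow w y \<longleftrightarrow> \<mu> $ j \<le> v j \<bullet> follow w x0" for j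
          using far wW width[OF that, of j w] lenW[OF wW] by (smt (verit))
        then show ?thesis by (simp add: code_def)
      qed
      then show "code \<mu> (follow w y) = code \<mu> (follow w z)" using yz by simp
    qed
    then show False using \<mu> by simp
  qed
  \<comment> \<open>Chosen so that the total volume bound for the slabs, one for each word in
    \<open>W n\<close> and each coordinate, is \<open>D * (card (W n) * c ^ n)\<close>.\<close>
  define D where "D = real CARD('d) * 2 * M * C * R * (2 * \<delta>) ^ (CARD('d) - 1)"
  have D0: "0 \<le> D" using M0 C_nonneg R0 \<delta>(1) by (simp add: D_def)
  have "negligible (?B \<inter> ball \<mu>0 \<delta>)"
  proof (rule iffD2[OF negligible_outer_le], intro allI impI)
    fix e :: real assume e: "e > 0"
    \<comment> \<open>Dividing by \<open>D + 1\<close> covers the case \<open>D = 0\<close>.\<close>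
    obtain n where n: "real (card (W n)) * c ^ n < e / (D + 1)"
      using \<delta>(2)[of "e / (D + 1)"] e D0 unfolding W_def by auto
    define slab where "slab p = {\<mu>\<in>ball \<mu>0 \<delta>. \<bar>\<mu> $ snd p - v (snd p) \<bullet> follow (fst p) x0\<bar> \<le> width n}" for p
    have "\<forall>p. \<exists>T. T \<in> lmeasurable \<and> slab p \<subseteq> T \<and>
        measure lebesgue T \<le> 2 * width n * (2 * \<delta>) ^ (CARD('d) - 1)"
      unfolding slab_def by (intro allI measure_slab_le width0 less_imp_le[OF \<delta>(1)])
    from choice[OF this] obtain T where T: "\<And>p. T p \<in> lmeasurable" "\<And>p. slab p \<subseteq> T p"
      "\<And>p. measure lebesgue (T p) \<le> 2 * width n * (2 * \<delta>) ^ (CARD('d) - 1)"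
      by blast
    define U where "U = (\<Union>p\<in>W n \<times> UNIV. T p)"
    have "?B \<inter> ball \<mu>0 \<delta> \<subseteq> U"
    proof
      fix \<mu> assume \<mu>: "\<mu> \<in> ?B \<inter> ball \<mu>0 \<delta>"
      then obtain w j where wj: "w \<in> W n" "\<bar>\<mu> $ j - v j \<bullet> follow w x0\<bar> \<le> width n"
        using cover by blast
      then have "\<mu> \<in> T (w, j)" using T(2)[of "(w, j)"] \<mu> by (auto simp: slab_def)
      then show "\<mu> \<in> U" using wj(1) by (auto simp: U_def)
    qed
    moreover have "U \<in> lmeasurable"
      unfolding U_def using finW T(1) by (intro fmeasurable.finite_UN) auto
    moreover have "measure lebesgue U \<le> e"
    proof -
      have "measure lebesgue U \<le> (\<Sum>p\<in>W n \<times> UNIV. measure lebesgue (T p))"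
        unfolding U_def using finW T(1) by (intro measure_UNION_le) (auto simp: fmeasurableD)
      also have "\<dots> \<le> (\<Sum>p\<in>W n \<times> (UNIV :: 'd set). 2 * width n * (2 * \<delta>) ^ (CARD('d) - 1))"
        by (intro sum_mono T(3))
      also have "\<dots> = D * (real (card (W n)) * c ^ n)"
        by (simp add: card_cartesian_product D_def width_def mult_ac)
      also have "\<dots> \<le> (D + 1) * (e / (D + 1))"
        using n D0 c by (intro mult_mono) auto
      also have "\<dots> = e" using D0 by simp
      finally show ?thesis .
    qed
    ultimately show "\<exists>T. ?B \<inter> ball \<mu>0 \<delta> \<subseteq> T \<and> T \<in> lmeasurable \<and> measure lebesgue T \<le> e"
      by blast
  qed
  then show "\<exists>U. openin (top_of_set ?B) U \<and> \<mu>0 \<in> U \<and> negligible U"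
    using \<mu>0 \<delta>(1) by (intro exI[of _ "?B \<inter> ball \<mu>0 \<delta>"]) (auto intro: openin_open_Int)
qed

end

section \<open>Application to the given maps\<close>

lemma op_infnorm_nonneg: "0 \<le> op_infnorm A"
proof -
  have "0 \<le> op_infnorm A * infnorm (1 :: real ^ 'a)"
    using op_infnorm_bound[of A 1] infnorm_pos_le[of "A *v 1"] by linarith
  moreover have "0 < infnorm (1 :: real ^ 'a)"
    by (simp add: infnorm_pos_lt vec_eq_iff)
  ultimately show ?thesis by (simp add: zero_le_mult_iff)
qed

lemma compact_domain_X: "compact (domain_X A k)"
proof -
  have "continuous_on UNIV (infnorm :: real ^ 'a \<Rightarrow> real)"
    using tendsto_infnorm[OF tendsto_ident_at] unfolding continuous_on_def by blast
  then have "closed (domain_X A k)"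
    unfolding domain_X_def by (intro closed_Collect_le continuous_intros) 
  moreover have "bounded (domain_X A k)"
    unfolding bounded_iff
  proof (intro exI ballI)
    fix y assume "y \<in> domain_X A k"
    then have "sqrt DIM(real ^ 'a) * infnorm y \<le> sqrt DIM(real ^ 'a) * (2 * radius A k)"
      by (intro mult_left_mono) (auto simp: domain_X_def)
    then show "norm y \<le> sqrt DIM(real ^ 'a) * (2 * radius A k)"
      using norm_le_infnorm[of y] by linarith
  qed
  ultimately show ?thesis by (simp add: compact_eq_bounded_closed)
qed

text \<open>The iteration is done in the maximum norm, so the cost of comparing the two norms is
  paid only once, independently of \<open>n\<close>.\<close>

lemma norm_funpow_matrix_vector_le:
  assumes "op_infnorm A \<le> c"
  shows "norm (((*v) A ^^ n) x) \<le> sqrt DIM(real ^ 'd) * c ^ n * norm (x :: real ^ 'd)"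
proof -
  have c: "0 \<le> c" using assms op_infnorm_nonneg[of A] by linarith
  have "infnorm (((*v) A ^^ n) x) \<le> c ^ n * infnorm x"
  proof (induction n)
    case (Suc n)
    have "infnorm (((*v) A ^^ Suc n) x) \<le> op_infnorm A * infnorm (((*v) A ^^ n) x)"
      by (simp add: op_infnorm_bound)
    also have "\<dots> \<le> c * (c ^ n * infnorm x)"
      using Suc assms c by (intro mult_mono infnorm_pos_le)
    finally show ?case by simp
  qed simp
  also have "\<dots> \<le> c ^ n * norm x" using c by (intro mult_left_mono infnorm_le_norm) simp
  finally have "sqrt DIM(real ^ 'd) * infnorm (((*v) A ^^ n) x) \<le> sqrt DIM(real ^ 'd) * (c ^ n * norm x)"
    by (intro mult_left_mono) auto
  then show ?thesis using norm_le_infnorm[of "((*v) A ^^ n) x"] by (simp only: mult.assoc)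
qed

lemma G_map_eq:
  "G_map A k \<mu> y = A *v y -
    (real_vec k + (\<chi> j. if j \<in> {j. \<mu> $ j \<le> unit_row A j \<bullet> y} then 1 else 0))"
  unfolding G_map_def branch_def sign_exponent_signs[OF coding_in_signs]
  by (simp add: coding_def vec_eq_iff)

theorem theorem4:
  fixes A :: "real ^ 'd ^ 'd" and k :: "int ^ 'd"
  assumes "invertible A"
    and "op_infnorm A < 1"
  shows "AE \<mu> in lebesgue. asymptotically_periodic (domain_X A k) (G_map A k \<mu>)"
proof -
  define \<tau> :: "'d set \<Rightarrow> real ^ 'd" where "\<tau> S = real_vec k + (\<chi> j. if j \<in> S then 1 else 0)" for S
  have inv: "A *v y - \<tau> S \<in> domain_X A k" if "y \<in> domain_X A k" for y S
  proof -
    \<comment> \<open>A parameter for which \<open>y\<close> has exactly the symbol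
      \<open>S\<close>: each branch at \<open>y\<close> thus occurs as some \<open>G_map\<close>,
      and invariance carries over.\<close>
    define \<mu> :: "real ^ 'd" where "\<mu> = (\<chi> j. unit_row A j \<bullet> y + (if j \<in> S then 0 else 1))"
    have "{j. \<mu> $ j \<le> unit_row A j \<bullet> y} = S" by (auto simp: \<mu>_def)
    then have "G_map A k \<mu> y = A *v y - \<tau> S" unfolding G_map_eq \<tau>_def by simp
    then show ?thesis using G_map_domain_X[OF assms(2) that, of \<mu>] by simp
  qed
  have "0 \<le> radius A k"
    using op_infnorm_nonneg[of A] by (simp add: radius_def infnorm_pos_le)
  then have zero: "0 \<in> domain_X A k" by (simp add: domain_X_def infnorm_0)
  \<comment> \<open>The maximum with 1/2 makes the rate positive by construction and keeps it below
    1; the square root compares the Euclidean with the maximum norm.\<close>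
  interpret affine_contraction "(*v) A" \<tau> "unit_row A" "domain_X A k"
    "sqrt DIM(real ^ 'd)" "max (op_infnorm A) (1/2)"
  proof
    show "norm (((*v) A ^^ n) x) \<le> sqrt DIM(real ^ 'd) * max (op_infnorm A) (1/2) ^ n * norm x" for n x
      by (rule norm_funpow_matrix_vector_le) simp
  qed (use assms(2) zero in \<open>auto intro: inv compact_domain_X
      simp: matrix_vector_right_distrib matrix_vector_mult_scaleR\<close>)
  have "G_map A k \<mu> = step \<mu>" for \<mu>
    by (rule ext) (simp only: G_map_eq step_def code_def \<tau>_def)
  then have "negligible {\<mu>. \<not> asymptotically_periodic (domain_X A k) (G_map A k \<mu>)}"
    using negligible_not_asymptotically_periodic by simp
  then show ?thesis
    unfolding negligible_iff_null_sets by (rule AE_I') auto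
qed

end
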